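(* Let $\sigma_1,\sigma_2$ be weight functions on $T$, let $\varphi:T\to T$ be a self map and $\psi:T\to\mathbb{C}$ a function. The weighted composition operator $W_{\psi,\varphi}:\mathbb{T}_{\sigma_1,\infty}\to\mathbb{T}_{\sigma_2,\infty}$, $W_{\psi,\varphi}(f)=\psi\,(f\circ\varphi)$, is an isometry if and only if $\varphi$ is onto and $$\sup_{x\in\varphi^{-1}(y)}\left|\frac{\sigma_2(x)\psi(x)}{\sigma_1(\varphi(x))}\right|=1\quad\text{for all } y\in T.$$
   Context: $T$ is an infinite rooted tree, identified with its vertex set; $|x|$ is the edge-counting distance from the root $o$ to the vertex $x$; $c_n$ is the number of vertices $x$ with $|x|=n$, $n\in\mathbb{N}_0=\{0,1,2,\dots\}$. Standing assumptions: every $c_n$ is finite and the sequence $\{c_n\}$ is unbounded. A weight function is a function $\sigma:T\to(0,\infty)$. For a weight $\sigma$ and $f:T\to\mathbb{C}$, put $\|f\|_{\sigma,\infty}=\sup_{x\in T}\sigma(x)|f(x)|$; $\mathbb{T}_{\sigma,\infty}$ is the set of all $f:T\to\mathbb{C}$ with $\|f\|_{\sigma,\infty}<\infty$. A linear operator $A:X\to Y$ is an isometry if it maps $X$ into $Y$ and $\|Af\|_Y=\|f\|_X$ for all $f\in X$ (surjectivity is not required). Convention: the supremum of a nonnegative quantity over the empty set is $0$. *)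

theory Defs
  imports Complex_Main "HOL-Library.Extended_Nonnegative_Real"
begin

text \<open>
  A simple undirected graph is given by a symmetric irreflexive adjacency relation on its type of
  vertices. The predicate \<open>tree\<close> of the AFP entry Graph-Theory is not used: it forbids directed
  cycles only, and a symmetric digraph with an edge always has one (back and forth along the edge).
\<close>

definition simple_graph :: "('v \<Rightarrow> 'v \<Rightarrow> bool) \<Rightarrow> bool" where
  "simple_graph E \<longleftrightarrow> symp E \<and> irreflp E"

definition graph_cycle :: "('v \<Rightarrow> 'v \<Rightarrow> bool) \<Rightarrow> 'v list \<Rightarrow> bool" where
  "graph_cycle E xs \<longleftrightarrow>
     length xs \<ge> 3 \<and> distinct xs \<and> successively E xs \<and> E (last xs) (hd xs)"

definition graph_tree :: "('v \<Rightarrow> 'v \<Rightarrow> bool) \<Rightarrow> bool" where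
  "graph_tree E \<longleftrightarrow>
     simple_graph E \<and> (\<forall>x y. E\<^sup>*\<^sup>* x y) \<and> (\<nexists>xs. graph_cycle E xs)"

text \<open>
  \<^term>\<open>(E ^^ n) x y\<close> says that there is a walk with exactly \<open>n\<close> edges from \<open>x\<close> to \<open>y\<close>. In a
  connected graph such an \<open>n\<close> exists, so that the minimum is meaningful.
\<close>

definition graph_dist :: "('v \<Rightarrow> 'v \<Rightarrow> bool) \<Rightarrow> 'v \<Rightarrow> 'v \<Rightarrow> nat" where
  "graph_dist E x y = (LEAST n. (E ^^ n) x y)"

definition level :: "('v \<Rightarrow> 'v \<Rightarrow> bool) \<Rightarrow> 'v \<Rightarrow> nat \<Rightarrow> 'v set" where
  "level E r n = {x. graph_dist E r x = n}"

definition weight :: "('v \<Rightarrow> real) \<Rightarrow> bool" where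
  "weight \<sigma> \<longleftrightarrow> (\<forall>x. \<sigma> x > 0)"

text \<open>The supremum is taken in the extended nonnegative reals, since it may be infinite.\<close>

definition wnorm :: "('v \<Rightarrow> real) \<Rightarrow> ('v \<Rightarrow> complex) \<Rightarrow> ennreal" where
  "wnorm \<sigma> f = (SUP x. ennreal (\<sigma> x * cmod (f x)))"

definition wspace :: "('v \<Rightarrow> real) \<Rightarrow> ('v \<Rightarrow> complex) set" where
  "wspace \<sigma> = {f. wnorm \<sigma> f < \<infinity>}"

definition linear_operator ::
  "('v \<Rightarrow> complex) set \<Rightarrow> ('w \<Rightarrow> complex) set \<Rightarrow> (('v \<Rightarrow> complex) \<Rightarrow> 'w \<Rightarrow> complex) \<Rightarrow> bool" where
  "linear_operator X Y A \<longleftrightarrow>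
     (\<forall>f\<in>X. A f \<in> Y) \<and>
     (\<forall>f\<in>X. \<forall>g\<in>X. A (\<lambda>x. f x + g x) = (\<lambda>x. A f x + A g x)) \<and>
     (\<forall>c. \<forall>f\<in>X. A (\<lambda>x. c * f x) = (\<lambda>x. c * A f x))"

definition isometry_between ::
  "('v \<Rightarrow> real) \<Rightarrow> ('w \<Rightarrow> real) \<Rightarrow> (('v \<Rightarrow> complex) \<Rightarrow> 'w \<Rightarrow> complex) \<Rightarrow> bool" where
  "isometry_between \<sigma>1 \<sigma>2 A \<longleftrightarrow>
     linear_operator (wspace \<sigma>1) (wspace \<sigma>2) A \<and>
     (\<forall>f\<in>wspace \<sigma>1. wnorm \<sigma>2 (A f) = wnorm \<sigma>1 f)"

definition weighted_comp ::
  "('v \<Rightarrow> complex) \<Rightarrow> ('v \<Rightarrow> 'v) \<Rightarrow> ('v \<Rightarrow> complex) \<Rightarrow> 'v \<Rightarrow> complex" where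
  "weighted_comp \<psi> \<phi> f = (\<lambda>x. \<psi> x * f (\<phi> x))"

text \<open>
  As a supremum of extended nonnegative reals, this is \<open>0\<close> when the fibre is empty and \<open>\<infinity>\<close> when
  the quantity is unbounded on it.
\<close>

definition fibre_sup ::
  "('v \<Rightarrow> real) \<Rightarrow> ('v \<Rightarrow> real) \<Rightarrow> ('v \<Rightarrow> complex) \<Rightarrow> ('v \<Rightarrow> 'v) \<Rightarrow> 'v \<Rightarrow> ennreal" where
  "fibre_sup \<sigma>1 \<sigma>2 \<psi> \<phi> y =
     (SUP x\<in>\<phi> -` {y}.
        ennreal (cmod (complex_of_real (\<sigma>2 x) * \<psi> x / complex_of_real (\<sigma>1 (\<phi> x)))))"

end

(* Grouping the supremum that defines the norm of the image by fibres of \<phi>, the norm of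
   \<psi> (f o \<phi>) is the supremum over y of the fibre supremum at y times \<sigma>1 y |f y|. If all fibre
   suprema are 1, this is the norm of f. Conversely, testing on the characteristic function
   of a point y isolates the fibre supremum at y, and an empty fibre would make it 0. *)

theory Submission
  imports Defs
begin

text \<open>Multiplying and dividing by \<open>\<sigma>1 (\<phi> x) > 0\<close> splits each term
  into the quotient of \<open>fibre_sup\<close> and a factor depending only on
  \<open>\<phi> x\<close>, which leaves the supremum over a fibre. Infinite suprema are allowed;
  where \<open>f y = 0\<close>, both sides use \<open>\<infinity> * 0 = 0\<close>.\<close>

lemma wnorm_weighted_comp:
  fixes \<sigma>1 \<sigma>2 :: "'v \<Rightarrow> real"
  assumes "weight \<sigma>1" and "weight \<sigma>2"
  shows "wnorm \<sigma>2 (weighted_comp \<psi> \<phi> f) =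
    (SUP y. fibre_sup \<sigma>1 \<sigma>2 \<psi> \<phi> y * ennreal (\<sigma>1 y * cmod (f y)))"
proof -
  let ?q = "\<lambda>x. ennreal (cmod (complex_of_real (\<sigma>2 x) * \<psi> x / complex_of_real (\<sigma>1 (\<phi> x))))"
  have pos: "\<sigma>1 x > 0" "\<sigma>2 x > 0" for x
    using assms by (auto simp: weight_def)
  have term_eq: "ennreal (\<sigma>2 x * cmod (weighted_comp \<psi> \<phi> f x)) =
      ?q x * ennreal (\<sigma>1 (\<phi> x) * cmod (f (\<phi> x)))" for x
    using pos[of x] pos(1)[of "\<phi> x"]
    by (simp add: ennreal_mult[symmetric] weighted_comp_def norm_mult norm_divide)
  \<comment> \<open>The index set is rewritten as the disjoint union of all fibres, so that the
    supremum can be iterated.\<close>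
  have "wnorm \<sigma>2 (weighted_comp \<psi> \<phi> f) =
      (SUP x\<in>(\<Union>y. \<phi> -` {y}). ?q x * ennreal (\<sigma>1 (\<phi> x) * cmod (f (\<phi> x))))"
    unfolding wnorm_def term_eq by (rule SUP_cong) auto
  also have "\<dots> = (SUP y. SUP x\<in>\<phi> -` {y}. ?q x * ennreal (\<sigma>1 (\<phi> x) * cmod (f (\<phi> x))))"
    by (rule SUP_UNION)
  also have "\<dots> = (SUP y. SUP x\<in>\<phi> -` {y}. ?q x * ennreal (\<sigma>1 y * cmod (f y)))"
    by (intro SUP_cong refl) auto
  also have "\<dots> = (SUP y. fibre_sup \<sigma>1 \<sigma>2 \<psi> \<phi> y * ennreal (\<sigma>1 y * cmod (f y)))"
    by (simp add: fibre_sup_def SUP_mult_right_ennreal)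
  finally show ?thesis .
qed

text \<open>All terms off \<open>y\<close> are 0, the bottom of \<open>ennreal\<close>. With
  \<open>a = 1\<close> this is the norm of a characteristic function, with \<open>a\<close> the
  fibre supremum that of its image.\<close>

lemma SUP_mult_point:
  fixes a :: "'v \<Rightarrow> ennreal"
  shows "(SUP x. a x * ennreal (\<sigma> x * cmod (of_bool (x = y)))) = a y * ennreal (\<sigma> y)"
proof (rule antisym)
  show "(SUP x. a x * ennreal (\<sigma> x * cmod (of_bool (x = y)))) \<le> a y * ennreal (\<sigma> y)"
    by (rule SUP_least) auto
  show "a y * ennreal (\<sigma> y) \<le> (SUP x. a x * ennreal (\<sigma> x * cmod (of_bool (x = y))))"
    by (rule SUP_upper2[where i = y]) auto
qed

theorem theorem14:
  fixes E :: "'v \<Rightarrow> 'v \<Rightarrow> bool" and r :: 'v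
    and \<sigma>1 \<sigma>2 :: "'v \<Rightarrow> real"
    and \<phi> :: "'v \<Rightarrow> 'v" and \<psi> :: "'v \<Rightarrow> complex"
  assumes "graph_tree E"
    and "infinite (UNIV :: 'v set)"
    and "\<And>n. finite (level E r n)"
    and "\<not> bdd_above (range (\<lambda>n. card (level E r n)))"
    and "weight \<sigma>1" and "weight \<sigma>2"
  shows "isometry_between \<sigma>1 \<sigma>2 (weighted_comp \<psi> \<phi>) \<longleftrightarrow>
    surj \<phi> \<and> (\<forall>y. fibre_sup \<sigma>1 \<sigma>2 \<psi> \<phi> y = 1)"
proof
  note norm_eq = wnorm_weighted_comp[OF \<open>weight \<sigma>1\<close> \<open>weight \<sigma>2\<close>]
  {
    assume iso: "isometry_between \<sigma>1 \<sigma>2 (weighted_comp \<psi> \<phi>)"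
    have one: "fibre_sup \<sigma>1 \<sigma>2 \<psi> \<phi> y = 1" for y
    proof -
      let ?\<delta> = "\<lambda>x. of_bool (x = y) :: complex"
      have "\<sigma>1 y > 0" using \<open>weight \<sigma>1\<close> by (simp add: weight_def)
      have norm_\<delta>: "wnorm \<sigma>1 ?\<delta> = ennreal (\<sigma>1 y)"
        using SUP_mult_point[of "\<lambda>_. 1" \<sigma>1 y] by (simp add: wnorm_def)
      then have "?\<delta> \<in> wspace \<sigma>1" by (simp add: wspace_def)
      then have "wnorm \<sigma>2 (weighted_comp \<psi> \<phi> ?\<delta>) = ennreal (\<sigma>1 y)"
        using iso norm_\<delta> unfolding isometry_between_def by metis
      then have "ennreal (\<sigma>1 y) * fibre_sup \<sigma>1 \<sigma>2 \<psi> \<phi> y = ennreal (\<sigma>1 y) * 1"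
        unfolding norm_eq SUP_mult_point by (simp add: mult.commute)
      \<comment> \<open>Cancellation in \<open>ennreal\<close> requires \<open>\<sigma>1 y\<close>
        to be nonzero and finite.\<close>
      then show ?thesis
        using \<open>\<sigma>1 y > 0\<close> by (subst (asm) ennreal_mult_cancel_left) auto
    qed
    have "y \<in> range \<phi>" for y
    proof (rule ccontr)
      assume "y \<notin> range \<phi>"
      then have "\<phi> -` {y} = {}" by auto
      then show False using one[of y] by (simp add: fibre_sup_def bot_ennreal)
    qed
    with one show "surj \<phi> \<and> (\<forall>y. fibre_sup \<sigma>1 \<sigma>2 \<psi> \<phi> y = 1)" by blast
  next
    assume "surj \<phi> \<and> (\<forall>y. fibre_sup \<sigma>1 \<sigma>2 \<psi> \<phi> y = 1)"
    \<comment> \<open>This holds for every \<open>f\<close>, even of infinite norm; on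
      \<open>wspace \<sigma>1\<close> it also shows that the image lies in
      \<open>wspace \<sigma>2\<close>.\<close>
    then have "wnorm \<sigma>2 (weighted_comp \<psi> \<phi> f) = wnorm \<sigma>1 f" for f
      by (simp add: norm_eq) (simp add: wnorm_def)
    then show "isometry_between \<sigma>1 \<sigma>2 (weighted_comp \<psi> \<phi>)"
      unfolding isometry_between_def linear_operator_def
      by (simp add: wspace_def) (simp add: weighted_comp_def algebra_simps)
  }
qed

end
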